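(* Let $q\in\mathbb Q_{>0}$, $a,b\in\mathbb N$ and $n,m\in\mathbb Z$ (possibly with $nm=0$). Suppose there is $t\in\mathbb Z$ such that either $qam=t^2$ and $qbn=(t+1)^2$, or $qam=t(t-1)$ and $qbn=t(t+1)$. Then the pattern $$x,\quad y,\quad q(ax+n)(by+m)$$ is partition regular if and only if the pattern $$x,\quad y,\quad (x+qbn)(y+qam)$$ is partition regular and either (a) $qam=t^2$, $qbn=(t+1)^2$ and $\dfrac{am+bn}{2ab}-\dfrac{1}{2qab}\in\mathbb Z$, or (b) $qam=t(t-1)$, $qbn=t(t+1)$ and $\dfrac{am+bn}{2ab}\in\mathbb Z$.
   Context: $\mathbb N$ denotes the set of positive integers ($0\notin\mathbb N$). A pattern $f_1(x,y),\dots,f_k(x,y)$ (with the $f_i$ rational-valued functions) is called partition regular if, for every finite colouring (partition into finitely many pieces) of $\mathbb N$, the set of monochromatic $k$-tuples $(f_1(u,v),\dots,f_k(u,v))$ with $u,v\in\mathbb N$ is infinite; here a tuple is monochromatic if all its entries belong to $\mathbb N$ and lie in the same colour. *)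

theory Defs
  imports Complex_Main "HOL-Library.Disjoint_Sets"
begin

text \<open>
  A pattern in two variables is a list of functions; only their values at positive arguments
  matter. The set required to be infinite consists of tuples of values, not of pairs \<open>(u, v)\<close>.
\<close>

definition monochromatic :: "nat set set \<Rightarrow> rat list \<Rightarrow> bool" where
  "monochromatic P zs \<longleftrightarrow> (\<exists>A\<in>P. \<forall>z\<in>set zs. z \<in> of_nat ` A)"

definition partition_regular :: "(nat \<Rightarrow> nat \<Rightarrow> rat) list \<Rightarrow> bool" where
  "partition_regular fs \<longleftrightarrow>
     (\<forall>P. partition_on {k::nat. k > 0} P \<and> finite P \<longrightarrow>
        infinite {zs. monochromatic P zs \<and>
                      (\<exists>u v. u > 0 \<and> v > 0 \<and> zs = map (\<lambda>f. f u v) fs)})"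

end

theory Submission
  imports Defs "HOL-Library.Ramsey" "HOL-Library.Nat_Bijection"
    "HOL-Computational_Algebra.Primes"
begin

text \<open>
  With \<open>c = q a b\<close>, \<open>A = q a m\<close>, \<open>B = q b n\<close>, the first pattern consists of the solutions of
  \<open>c z = (c x + B) (c y + A)\<close>, that is, of those solutions of \<open>Z = (X + B) (Y + A)\<close> (the second
  pattern) which lie in \<open>c \<nat>\<close>. Colouring by residues makes monochromatic solutions \<open>p\<close>-adically
  close to a fixed point of \<open>X \<mapsto> (X + B) (X + A)\<close>. In case (a) this is the double root
  \<open>k = - t (t + 1)\<close>; in case (b) the roots are \<open>k = - t\<^sup>2\<close> and \<open>k + 1\<close>. Near \<open>k + 1\<close> the equation
  reads \<open>Z = X Y + (1 - t) X + (1 + t) Y\<close>, whose linear part violates Rado's condition when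
  \<open>t \<noteq> 0\<close>, so a further colouring by last \<open>p\<close>-adic digits excludes that root. Hence
  monochromatic solutions can be forced to satisfy \<open>X \<equiv> k\<close> modulo any given number, and rescaling
  by \<open>c\<close> is possible exactly if \<open>k / c\<close> is an integer. For \<open>t = 0\<close> in case (b) both patterns are
  partition regular by Schur's theorem.
\<close>

section \<open>Partition regularity as monochromatic solutions of one equation\<close>

definition scaled_sol :: "rat \<Rightarrow> int \<Rightarrow> int \<Rightarrow> nat \<Rightarrow> nat \<Rightarrow> nat \<Rightarrow> bool" where
  "scaled_sol c A B x y z \<longleftrightarrow> x > 0 \<and> y > 0 \<and> z > 0 \<and>
     c * of_nat z = (c * of_nat x + of_int B) * (c * of_nat y + of_int A)"

text \<open>For \<open>c > 0\<close> the pair determines \<open>z\<close>, so counting pairs amounts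
  to counting triples.\<close>

definition mono_sols :: "rat \<Rightarrow> int \<Rightarrow> int \<Rightarrow> (nat \<Rightarrow> nat) \<Rightarrow> (nat \<times> nat) set" where
  "mono_sols c A B f = {(x, y). \<exists>z. scaled_sol c A B x y z \<and> f x = f y \<and> f y = f z}"

text \<open>Colour classes form a partition and labelled classes form a colouring. Since
  \<open>x\<close> and \<open>y\<close> are themselves entries, infinitely many tuples mean
  infinitely many pairs.\<close>

lemma partition_regular_iff_colouring:
  fixes F :: "nat \<Rightarrow> nat \<Rightarrow> rat"
  shows "partition_regular [\<lambda>x y. of_nat x, \<lambda>x y. of_nat y, F] \<longleftrightarrow>
    (\<forall>f::nat \<Rightarrow> nat. finite (range f) \<longrightarrow>
       infinite {(x, y). x > 0 \<and> y > 0 \<and> (\<exists>z>0. of_nat z = F x y \<and> f x = f y \<and> f y = f z)})"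
    (is "_ \<longleftrightarrow> (\<forall>f. _ \<longrightarrow> infinite (?S f))")
proof
  assume pr: "partition_regular [\<lambda>x y. of_nat x, \<lambda>x y. of_nat y, F]"
  show "\<forall>f. finite (range f) \<longrightarrow> infinite (?S f)"
  proof (intro allI impI)
    fix f :: "nat \<Rightarrow> nat" assume fin: "finite (range f)"
    define C where "C i = {k. k > 0 \<and> f k = i}" for i
    define P where "P = C ` f ` {k. k > 0}"
    have part: "partition_on {k::nat. k > 0} P"
      unfolding partition_on_def disjoint_def P_def C_def by auto
    have "finite P"
      unfolding P_def by (intro finite_imageI finite_subset[OF _ fin]) auto
    with part pr have inf: "infinite {zs. Defs.monochromatic P zs \<and>
       (\<exists>u v. u > 0 \<and> v > 0 \<and> zs = map (\<lambda>f. f u v) [\<lambda>x y. of_nat x, \<lambda>x y. of_nat y, F])}"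
      unfolding partition_regular_def by blast
    have "{zs. Defs.monochromatic P zs \<and>
       (\<exists>u v. u > 0 \<and> v > 0 \<and> zs = map (\<lambda>f. f u v) [\<lambda>x y. of_nat x, \<lambda>x y. of_nat y, F])}
       \<subseteq> (\<lambda>(x, y). [of_nat x, of_nat y, F x y]) ` ?S f"
      unfolding Defs.monochromatic_def P_def C_def by (fastforce simp: image_iff)
    with inf show "infinite (?S f)"
      using finite_surj by blast
  qed
next
  assume H: "\<forall>f. finite (range f) \<longrightarrow> infinite (?S f)"
  show "partition_regular [\<lambda>x y. of_nat x, \<lambda>x y. of_nat y, F]"
    unfolding partition_regular_def
  proof (intro allI impI)
    fix P :: "nat set set" assume P: "partition_on {k. k > 0} P \<and> finite P"
    then obtain e :: "nat set \<Rightarrow> nat" where e: "inj_on e P"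
      using finite_imp_inj_to_nat_seg by metis
    define cl where "cl x = (THE X. X \<in> P \<and> x \<in> X)" for x
    have cl: "cl x \<in> P \<and> x \<in> cl x" if "x > 0" for x
    proof -
      have "\<exists>!X. X \<in> P \<and> x \<in> X"
        using P that unfolding partition_on_def disjoint_def by blast
      then show ?thesis unfolding cl_def by (rule theI')
    qed
    \<comment> \<open>\<open>0\<close> lies in no class, so \<open>cl 0\<close> is unspecified; the
      default keeps the range inside a known finite set.\<close>
    define f where "f x = (if x > 0 then e (cl x) else 0)" for x
    have "range f \<subseteq> insert 0 (e ` P)"
      using cl by (auto simp: f_def)
    then have "finite (range f)"
      using P finite_subset by blast
    with H have inf: "infinite (?S f)" by blast
    have inj: "inj (\<lambda>(x, y). [of_nat x, of_nat y, F x y] :: rat list)"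
      by (auto simp: inj_on_def)
    have "Defs.monochromatic P [of_nat x, of_nat y, F x y]" "x > 0" "y > 0"
      if xy: "(x, y) \<in> ?S f" for x y
    proof -
      from xy obtain z where pos: "0 < x" "0 < y" "0 < z" and zF: "of_nat z = F x y"
        and "f x = f y" "f y = f z"
        by blast
      then have "cl x = cl y" "cl y = cl z"
        using e cl by (auto simp: f_def inj_on_def)
      then have "x \<in> cl x" "y \<in> cl x" "z \<in> cl x" "cl x \<in> P"
        using cl pos by metis+
      then show "Defs.monochromatic P [of_nat x, of_nat y, F x y]"
        using zF[symmetric] unfolding Defs.monochromatic_def by auto
      show "x > 0" "y > 0" by fact+
    qed
    note mono = this
    have "(\<lambda>(x, y). [of_nat x, of_nat y, F x y]) ` ?S f \<subseteq> {zs. Defs.monochromatic P zs \<and>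
       (\<exists>u v. u > 0 \<and> v > 0 \<and> zs = map (\<lambda>f. f u v) [\<lambda>x y. of_nat x, \<lambda>x y. of_nat y, F])}"
    proof (rule image_subsetI)
      fix p assume p: "p \<in> ?S f"
      obtain x y where xy: "p = (x, y)" by (cases p)
      show "(case p of (x, y) \<Rightarrow> [of_nat x, of_nat y, F x y]) \<in> {zs. Defs.monochromatic P zs \<and>
        (\<exists>u v. u > 0 \<and> v > 0 \<and> zs = map (\<lambda>f. f u v) [\<lambda>x y. of_nat x, \<lambda>x y. of_nat y, F])}"
        using mono[OF p[unfolded xy]] unfolding xy by auto
    qed
    with inf inj show "infinite {zs. Defs.monochromatic P zs \<and>
       (\<exists>u v. u > 0 \<and> v > 0 \<and> zs = map (\<lambda>f. f u v) [\<lambda>x y. of_nat x, \<lambda>x y. of_nat y, F])}"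
      by (meson finite_imageD finite_subset inj_on_subset subset_UNIV)
  qed
qed

lemma partition_regular_iff_mono_sols:
  assumes "c > 0"
    and "\<And>x y. c * F x y = (c * of_nat x + of_int B) * (c * of_nat y + of_int A)"
  shows "partition_regular [\<lambda>x y. of_nat x, \<lambda>x y. of_nat y, F] \<longleftrightarrow>
    (\<forall>f. finite (range f) \<longrightarrow> infinite (mono_sols c A B f))"
proof -
  have "of_nat z = F x y \<longleftrightarrow>
      c * of_nat z = (c * of_nat x + of_int B) * (c * of_nat y + of_int A)" for x y z
    using assms(1) by (simp flip: assms(2))
  then have "{(x, y). x > 0 \<and> y > 0 \<and> (\<exists>z>0. of_nat z = F x y \<and> f x = f y \<and> f y = f z)}
      = mono_sols c A B f" for f
    unfolding mono_sols_def scaled_sol_def by auto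
  then show ?thesis
    unfolding partition_regular_iff_colouring by simp
qed

section \<open>Finite colourings from products and residues\<close>

lemma finite_range_prod_encode:
  assumes "finite (range f)" "finite (range g)"
  shows "finite (range (\<lambda>x. prod_encode (f x, g x)))"
proof -
  have "range (\<lambda>x. prod_encode (f x, g x)) \<subseteq> prod_encode ` (range f \<times> range g)"
    by auto
  then show ?thesis
    using assms finite_subset by blast
qed

lemma finite_range_mod: "d > 0 \<Longrightarrow> finite (range (\<lambda>x::nat. nat (h x mod int d)))"
  by (rule finite_subset[of _ "{..<d}"]) (auto simp: nat_less_iff)

section \<open>A \<open>p\<close>-adic obstruction to linear relations\<close>

text \<open>\<open>x\<close> absorbs at most \<open>a\<close> of the \<open>a + b\<close> factors
  \<open>p\<close>, so at least \<open>b\<close> are left for \<open>y\<close>.\<close>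

lemma prime_power_dvd_mult_cancel:
  fixes p x y :: int
  assumes "prime p" "p ^ (a + b) dvd x * y" "\<not> p ^ Suc a dvd x"
  shows "p ^ b dvd y"
proof -
  have "x \<noteq> 0" using assms(3) by auto
  define i where "i = multiplicity p x"
  have "i \<le> a"
    using assms(3) multiplicity_dvd'[of "Suc a" p x] unfolding i_def by linarith
  obtain x' where x': "x = p ^ i * x'" "\<not> p dvd x'"
    using multiplicity_decompose'[of x p] \<open>x \<noteq> 0\<close> assms(1) i_def by (metis not_prime_unit)
  have "p ^ (i + b) dvd p ^ i * (x' * y)"
    using assms(2) \<open>i \<le> a\<close> x'(1)
    by (metis add_le_cancel_right dvd_trans le_imp_power_dvd mult.assoc)
  then have "p ^ b dvd x' * y"
    using assms(1) by (simp add: power_add)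
  moreover have "coprime (p ^ b) x'"
    using assms(1) x'(2) by (simp add: prime_imp_coprime)
  ultimately show ?thesis
    by (simp add: coprime_dvd_mult_right_iff)
qed

text \<open>
  Rado's obstruction: the coefficients \<open>1\<close>, \<open>t - 1\<close>, \<open>-(t + 1)\<close> have no vanishing subsum
  (zero coefficients apart), so the terms of minimal \<open>p\<close>-adic valuation cannot cancel.
\<close>

lemma no_monochromatic_linear_relation:
  fixes p t Wx Wy Wz :: int
  assumes p: "prime p" and t: "t \<noteq> 0" and J: "p ^ J > \<bar>t\<bar> + 3" "J > 0"
    and pos: "Wx > 0" "Wy > 0" "Wz > 0"
    and vals: "multiplicity p Wx mod J = multiplicity p Wz mod J"
      "multiplicity p Wy mod J = multiplicity p Wz mod J"
    and units: "(Wx div p ^ multiplicity p Wx) mod p ^ J = (Wz div p ^ multiplicity p Wz) mod p ^ J"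
      "(Wy div p ^ multiplicity p Wy) mod p ^ J = (Wz div p ^ multiplicity p Wz) mod p ^ J"
    and dvd: "p ^ (J + multiplicity p Wx) dvd Wz + (t - 1) * Wx - (t + 1) * Wy"
      "p ^ (J + multiplicity p Wy) dvd Wz + (t - 1) * Wx - (t + 1) * Wy"
  shows False
proof -
  let ?v = "multiplicity p"
  \<comment> \<open>A term whose coefficient \<open>t - 1\<close> or \<open>t + 1\<close> is zero
    drops out of the relation, so its valuation must not enter the minimum.\<close>
  define V where "V = {?v Wz} \<union> (if t = 1 then {} else {?v Wx}) \<union> (if t = -1 then {} else {?v Wy})"
  define \<mu> where "\<mu> = Min V"
  have V: "finite V" "V \<noteq> {}" by (auto simp: V_def)
  have \<mu>: "\<mu> \<in> V" "\<And>v. v \<in> V \<Longrightarrow> \<mu> \<le> v"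
    using V by (auto simp: \<mu>_def)
  define w where "w = Wz div p ^ ?v Wz"
  have nd: "\<not> p dvd w"
    unfolding w_def using pos(3) p by (intro multiplicity_decompose) auto
  define \<delta> :: "int \<Rightarrow> int" where "\<delta> W = (if ?v W = \<mu> then 1 else 0)" for W
  have mod: "\<mu> mod J = ?v Wz mod J"
    using \<mu>(1) vals by (auto simp: V_def split: if_splits)
  \<comment> \<open>At valuation \<open>\<mu>\<close> the unit parts agree modulo
    \<open>p ^ J\<close>; any larger valuation exceeds \<open>\<mu>\<close> by a multiple of
    \<open>J\<close>, so \<open>W\<close> vanishes to this order.\<close>
  have approx: "p ^ (\<mu> + J) dvd W - p ^ \<mu> * w * \<delta> W"
    if W: "?v W mod J = ?v Wz mod J" "(W div p ^ ?v W) mod p ^ J = w mod p ^ J" "\<mu> \<le> ?v W" for W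
  proof (cases "?v W = \<mu>")
    case True
    have "p ^ J dvd W div p ^ \<mu> - w"
      using W(2) True by (simp add: mod_eq_dvd_iff)
    then have "p ^ \<mu> * p ^ J dvd p ^ \<mu> * (W div p ^ \<mu> - w)"
      by (rule mult_dvd_mono[OF dvd_refl])
    moreover have "p ^ \<mu> * (W div p ^ \<mu>) = W"
      using multiplicity_dvd[of p W] True by simp
    ultimately show ?thesis
      using True by (simp add: \<delta>_def power_add algebra_simps)
  next
    case False
    then have "\<mu> < ?v W" using W(3) by simp
    moreover have "J dvd ?v W - \<mu>"
      using W(1,3) mod by (metis mod_eq_dvd_iff_nat)
    ultimately have "\<mu> + J \<le> ?v W"
      using dvd_imp_le[of J "?v W - \<mu>"] by linarith
    then show ?thesis
      using False multiplicity_dvd'[of "\<mu> + J" p W] by (simp add: \<delta>_def)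
  qed
  have 1: "p ^ (\<mu> + J) dvd Wz - p ^ \<mu> * w * \<delta> Wz"
    using \<mu>(2) by (intro approx) (auto simp: V_def w_def)
  have 2: "p ^ (\<mu> + J) dvd (t - 1) * (Wx - p ^ \<mu> * w * \<delta> Wx)"
  proof (cases "t = 1")
    case False
    then show ?thesis
      using \<mu>(2) vals(1) units(1) by (intro dvd_mult approx) (auto simp: V_def w_def)
  qed auto
  have 3: "p ^ (\<mu> + J) dvd (t + 1) * (Wy - p ^ \<mu> * w * \<delta> Wy)"
  proof (cases "t = -1")
    case False
    then show ?thesis
      using \<mu>(2) vals(2) units(2) by (intro dvd_mult approx) (auto simp: V_def w_def)
  qed auto
  \<comment> \<open>\<open>Wy\<close> has nonzero coefficient for \<open>t = 1\<close>, and
    \<open>Wx\<close> has otherwise; so one of the two hypotheses \<open>dvd\<close> always reaches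
    the order \<open>\<mu> + J\<close>.\<close>
  have 4: "p ^ (\<mu> + J) dvd Wz + (t - 1) * Wx - (t + 1) * Wy"
  proof (cases "t = 1")
    case True
    then have "\<mu> \<le> ?v Wy" using \<mu>(2) by (auto simp: V_def)
    then have "p ^ (\<mu> + J) dvd p ^ (J + ?v Wy)" by (intro le_imp_power_dvd) simp
    then show ?thesis using dvd(2) dvd_trans by blast
  next
    case False
    then have "\<mu> \<le> ?v Wx" using \<mu>(2) by (auto simp: V_def)
    then have "p ^ (\<mu> + J) dvd p ^ (J + ?v Wx)" by (intro le_imp_power_dvd) simp
    then show ?thesis using dvd(1) dvd_trans by blast
  qed
  \<comment> \<open>The subsum of coefficients at minimal valuation. It is smaller than
    \<open>p ^ J\<close> in absolute value, so divisibility by \<open>p ^ J\<close> makes it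
    zero.\<close>
  define \<sigma> where "\<sigma> = \<delta> Wz + (t - 1) * \<delta> Wx - (t + 1) * \<delta> Wy"
  have "p ^ (\<mu> + J) dvd (Wz + (t - 1) * Wx - (t + 1) * Wy) - (Wz - p ^ \<mu> * w * \<delta> Wz)
      - (t - 1) * (Wx - p ^ \<mu> * w * \<delta> Wx) + (t + 1) * (Wy - p ^ \<mu> * w * \<delta> Wy)"
    by (intro dvd_add[OF dvd_diff[OF dvd_diff[OF 4 1] 2] 3])
  also have "\<dots> = p ^ \<mu> * (w * \<sigma>)"
    by (simp add: \<sigma>_def algebra_simps)
  finally have "p ^ J dvd w * \<sigma>"
    using p by (auto simp: power_add)
  moreover have "coprime (p ^ J) w"
    using p nd by (simp add: prime_imp_coprime)
  ultimately have "p ^ J dvd \<sigma>"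
    by (simp add: coprime_dvd_mult_right_iff)
  moreover have "\<bar>\<sigma>\<bar> < p ^ J"
    using J(1) by (auto simp: \<sigma>_def \<delta>_def)
  ultimately have "\<sigma> = 0"
    using dvd_imp_le_int[of \<sigma> "p ^ J"] by force
  \<comment> \<open>The possible subsums are \<open>1\<close>, \<open>t - 1\<close>,
    \<open>-(t + 1)\<close>, \<open>t\<close>, \<open>-t\<close>, \<open>-2\<close> and
    \<open>-1\<close>. As \<open>t\<close> is nonzero, only a lone zero coefficient vanishes, and
    the minimum is attained at a term with nonzero coefficient.\<close>
  moreover have "(\<delta> Wz = 1) \<or> (t \<noteq> 1 \<and> \<delta> Wx = 1) \<or> (t \<noteq> -1 \<and> \<delta> Wy = 1)"
    using \<mu>(1) by (auto simp: V_def \<delta>_def split: if_splits)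
  ultimately show False
    using t by (auto simp: \<sigma>_def \<delta>_def split: if_splits)
qed

section \<open>Colourings that force solutions close to the root \<open>k\<close>\<close>

text \<open>The equation of \<open>scaled_sol\<close> for \<open>c = r / s\<close>, multiplied by
  \<open>s ^ 2\<close>.\<close>

definition int_sol :: "int \<Rightarrow> int \<Rightarrow> int \<Rightarrow> int \<Rightarrow> nat \<Rightarrow> nat \<Rightarrow> nat \<Rightarrow> bool" where
  "int_sol r s A B x y z \<longleftrightarrow> x > 0 \<and> y > 0 \<and> z > 0 \<and>
     s * r * int z = (r * int x + s * B) * (r * int y + s * A)"

text \<open>
  The integers \<open>r\<close>, \<open>s\<close> stand for \<open>c = r / s\<close>, not necessarily in lowest terms; the
  divisibility expresses that \<open>c x\<close> is close to \<open>k\<close>.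
\<close>

definition forces_dvd :: "int \<Rightarrow> int \<Rightarrow> int \<Rightarrow> int \<Rightarrow> int \<Rightarrow> int \<Rightarrow> bool" where
  "forces_dvd r s A B k D \<longleftrightarrow> (\<exists>g::nat \<Rightarrow> nat. finite (range g) \<and>
     (\<forall>x y z. int_sol r s A B x y z \<and> g x = g y \<and> g y = g z \<longrightarrow> D dvd r * int x - s * k))"

text \<open>Modulo \<open>M\<close> both \<open>y\<close> and \<open>z\<close> may be replaced by
  \<open>x\<close>, which turns the equation into a fixed point condition.\<close>

lemma cong_self_map:
  fixes M r s A B x y z :: int
  assumes "s * r * z = (r * x + s * B) * (r * y + s * A)" "M dvd x - y" "M dvd x - z"
  shows "M dvd (r * x + s * B) * (r * x + s * A) - s * r * x"
proof -
  have "(r * x + s * B) * (r * x + s * A) - s * r * x =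
      (r * x + s * B) * r * (x - y) - s * r * (x - z)"
    using assms(1) by (simp add: algebra_simps)
  then show ?thesis
    using assms(2,3) by (metis dvd_diff dvd_mult)
qed

lemma nat_mod_eq_imp_dvd:
  assumes "nat (int x mod int d) = nat (int y mod int d)" "d > 0"
  shows "int d dvd int x - int y"
  using assms by (simp add: eq_nat_nat_iff mod_eq_dvd_iff)

text \<open>The fixed point polynomial is a perfect square here, so residues modulo
  \<open>D ^ 2\<close> give divisibility by \<open>D\<close> of its root.\<close>

lemma forces_dvd_square:
  assumes "D > 0"
  shows "forces_dvd r s (t\<^sup>2) ((t + 1)\<^sup>2) (- (t * (t + 1))) D"
  unfolding forces_dvd_def
proof (intro exI[of _ "\<lambda>x. nat (int x mod int (nat (D\<^sup>2)))"] conjI allI impI)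
  show "finite (range (\<lambda>x. nat (int x mod int (nat (D\<^sup>2)))))"
    using assms by (intro finite_range_mod) simp
  fix x y z
  assume *: "int_sol r s (t\<^sup>2) ((t + 1)\<^sup>2) x y z \<and>
    nat (int x mod int (nat (D\<^sup>2))) = nat (int y mod int (nat (D\<^sup>2))) \<and>
    nat (int y mod int (nat (D\<^sup>2))) = nat (int z mod int (nat (D\<^sup>2)))"
  then have "D\<^sup>2 dvd int x - int y" "D\<^sup>2 dvd int x - int z"
    using assms nat_mod_eq_imp_dvd[of x "nat (D\<^sup>2)" y] nat_mod_eq_imp_dvd[of x "nat (D\<^sup>2)" z]
    by auto
  then have "D\<^sup>2 dvd (r * int x + s * (t + 1)\<^sup>2) * (r * int x + s * t\<^sup>2) - s * r * int x"
    using * by (intro cong_self_map[of s r "int z" _ _ "int y"]) (simp_all add: int_sol_def)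
  also have "\<dots> = (r * int x - s * (- (t * (t + 1))))\<^sup>2"
    by (simp add: power2_eq_square algebra_simps)
  finally show "D dvd r * int x - s * (- (t * (t + 1)))"
    by simp
qed

text \<open>The fixed point polynomial has the roots \<open>k = - t ^ 2\<close> and
  \<open>k + 1\<close>. Colouring by residue, by valuation modulo \<open>J\<close> and by the lowest
  nonzero digits of the distance to \<open>k + 1\<close> excludes the latter root.\<close>

lemma forces_dvd_prime_power:
  assumes p: "prime p" and t: "t \<noteq> 0" and r: "r > 0" and s: "s > 0"
  shows "forces_dvd r s (t * (t - 1)) (t * (t + 1)) (- t\<^sup>2) (p ^ e)"
proof -
  have p1: "p > 1" using p prime_gt_1_int by blast
  obtain J0 where "p ^ J0 > \<bar>t\<bar> + 3"
    using p1 real_arch_pow[of "of_int p" "of_int (\<bar>t\<bar> + 3)"]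
    by (metis of_int_1_less_iff of_int_less_iff of_int_power)
  then obtain J where J: "p ^ J > \<bar>t\<bar> + 3" "J > 0"
    using p1 power_increasing[of J0 "Suc J0" p] by (metis le_SucI order.refl order_less_le_trans less_imp_le zero_less_Suc)
  define \<sigma> where "\<sigma> = multiplicity p s"
  have \<sigma>: "\<not> p ^ Suc \<sigma> dvd s"
    unfolding \<sigma>_def using p s
    by (subst power_dvd_iff_le_multiplicity) auto
  \<comment> \<open>The first \<open>\<sigma>\<close> is lost in splitting \<open>u * W x\<close>.
    Of the rest, \<open>\<sigma>\<close> pays for cancelling \<open>s\<close>, \<open>J\<close>
    feeds the linear obstruction and \<open>e\<close> is the final precision.\<close>
  define E where "E = \<sigma> + (\<sigma> + J + e)"
  \<comment> \<open>\<open>W x / s\<close> is the difference \<open>c x - (k + 1)\<close>; it is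
    positive for positive \<open>x\<close> because \<open>t\<close> is nonzero.\<close>
  define W where "W x = r * int x + s * (t\<^sup>2 - 1)" for x
  define val where "val x = multiplicity p (W x)" for x
  define g1 where "g1 x = nat (int x mod int (nat (p ^ E)))" for x
  define g2 where "g2 x = nat (int (val x) mod int J)" for x
  define g3 where "g3 x = nat ((W x div p ^ val x) mod int (nat (p ^ J)))" for x
  define g where "g x = prod_encode (g1 x, prod_encode (g2 x, g3 x))" for x
  have "finite (range g)"
    unfolding g_def g1_def g2_def g3_def using p1 J(2)
    by (intro finite_range_prod_encode finite_range_mod) auto
  moreover have "p ^ e dvd r * int x - s * (- t\<^sup>2)"
    if sol: "int_sol r s (t * (t - 1)) (t * (t + 1)) x y z" and mono: "g x = g y" "g y = g z" for x y z
  proof -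
    have eqs: "g1 x = g1 y" "g1 y = g1 z" "g2 x = g2 y" "g2 y = g2 z" "g3 x = g3 y" "g3 y = g3 z"
      using mono by (auto simp: g_def)
    have cong: "p ^ E dvd int x - int y" "p ^ E dvd int x - int z"
      using eqs(1,2) p1 nat_mod_eq_imp_dvd[of x "nat (p ^ E)" y] nat_mod_eq_imp_dvd[of x "nat (p ^ E)" z]
      by (auto simp: g1_def)
    have eq: "s * r * int z = (r * int x + s * (t * (t + 1))) * (r * int y + s * (t * (t - 1)))"
      and xyz: "x > 0" "y > 0" "z > 0"
      using sol by (auto simp: int_sol_def)
    define u where "u = r * int x + s * t\<^sup>2"
    have uW: "u = W x + s" by (simp add: u_def W_def algebra_simps)
    have "p ^ E dvd (r * int x + s * (t * (t + 1))) * (r * int x + s * (t * (t - 1))) - s * r * int x"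
      using cong eq by (intro cong_self_map[of s r "int z" _ _ "int y"])
    also have "\<dots> = u * W x"
      by (simp add: u_def W_def power2_eq_square algebra_simps)
    finally have dvd: "p ^ E dvd u * W x" .
    have Wpos: "W w > 0" if "w > 0" for w
    proof -
      have "t\<^sup>2 \<ge> 1" using t by (simp add: int_one_le_iff_zero_less)
      then show ?thesis
        using that r s unfolding W_def by (intro add_pos_nonneg mult_pos_pos mult_nonneg_nonneg) auto
    qed
    \<comment> \<open>Otherwise \<open>W x\<close> is highly divisible, that is, \<open>c x\<close>
      is near the wrong root \<open>k + 1\<close>.\<close>
    have "p ^ Suc \<sigma> dvd u"
    proof (rule ccontr)
      assume "\<not> p ^ Suc \<sigma> dvd u"
      then have Wx: "p ^ (\<sigma> + J + e) dvd W x"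
        using prime_power_dvd_mult_cancel[OF p dvd[unfolded E_def]] by blast
      have "p ^ (\<sigma> + J + e) dvd p ^ E"
        unfolding E_def by (intro le_imp_power_dvd) simp
      then have "p ^ (\<sigma> + J + e) dvd r * (int x - int y)"
        using cong(1) dvd_trans dvd_mult by blast
      also have "r * (int x - int y) = W x - W y"
        by (simp add: W_def algebra_simps)
      finally have Wy: "p ^ (\<sigma> + J + e) dvd W y"
        using Wx by (metis dvd_diff_right_iff dvd_diffD1 dvd_diff_commute)
      \<comment> \<open>Recentred at \<open>k + 1\<close>, the equation reads
        \<open>s * R = W x * W y\<close>: a linear form equals a product.\<close>
      define R where "R = W z + (t - 1) * W x - (t + 1) * W y"
      have "s * R = s * r * int z + s * (s * (t\<^sup>2 - 1)) + s * ((t - 1) * W x - (t + 1) * W y)"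
        by (simp add: R_def W_def algebra_simps)
      also have "\<dots> = W x * W y"
        unfolding eq by (simp add: W_def power2_eq_square algebra_simps)
      finally have sR: "s * R = W x * W y" .
      \<comment> \<open>One factor of the product is divisible by \<open>p ^ (\<sigma> + J)\<close>,
        so the product has valuation well above that of the other factor; cancelling
        \<open>s\<close> costs \<open>\<sigma>\<close>.\<close>
      have Rdvd: "p ^ (J + multiplicity p V) dvd R"
        if V: "s * R = U * V" "p ^ (\<sigma> + J + e) dvd U" for U V
      proof -
        have "p ^ (\<sigma> + J) dvd U"
          using V(2) by (metis dvd_mult_left power_add)
        then have "p ^ (\<sigma> + J) * p ^ multiplicity p V dvd U * V"
          by (intro mult_dvd_mono multiplicity_dvd)
        then have "p ^ (\<sigma> + (J + multiplicity p V)) dvd s * R"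
          unfolding V(1) by (simp add: power_add mult.assoc)
        then show ?thesis
          using prime_power_dvd_mult_cancel[OF p] \<sigma> by blast
      qed
      have "p ^ (J + val x) dvd R" "p ^ (J + val y) dvd R"
        unfolding val_def using sR Wx Wy
        by (auto intro: Rdvd simp: mult.commute)
      moreover have "val x mod J = val z mod J" "val y mod J = val z mod J"
        using eqs(3,4) by (auto simp: g2_def simp flip: zmod_int)
      moreover have "(W x div p ^ val x) mod p ^ J = (W z div p ^ val z) mod p ^ J"
         "(W y div p ^ val y) mod p ^ J = (W z div p ^ val z) mod p ^ J"
        using eqs(5,6) p1 by (auto simp: g3_def eq_nat_nat_iff)
      ultimately show False
        using no_monochromatic_linear_relation[OF p t J Wpos Wpos Wpos, of x y z] xyz
        unfolding R_def val_def by blast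
    qed
    \<comment> \<open>\<open>u\<close> and \<open>W x\<close> differ by \<open>s\<close>, which
      \<open>p ^ Suc \<sigma>\<close> does not divide.\<close>
    then have "\<not> p ^ Suc \<sigma> dvd W x"
      using \<sigma> uW by (metis dvd_add_right_iff)
    then have "p ^ (\<sigma> + J + e) dvd u"
      using prime_power_dvd_mult_cancel[OF p, of \<sigma> "\<sigma> + J + e" "W x" u] dvd
      by (simp add: E_def mult.commute)
    then have "p ^ e dvd u"
      by (metis dvd_mult_right power_add)
    then show ?thesis
      by (simp add: u_def)
  qed
  ultimately show ?thesis
    unfolding forces_dvd_def by blast
qed

lemma forces_dvd_mult_coprime:
  assumes "forces_dvd r s A B k D" "forces_dvd r s A B k D'" "coprime D D'"
  shows "forces_dvd r s A B k (D * D')"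
proof -
  obtain g :: "nat \<Rightarrow> nat" where g: "finite (range g)"
    "\<forall>x y z. int_sol r s A B x y z \<and> g x = g y \<and> g y = g z \<longrightarrow> D dvd r * int x - s * k"
    using assms(1) unfolding forces_dvd_def by blast
  obtain h :: "nat \<Rightarrow> nat" where h: "finite (range h)"
    "\<forall>x y z. int_sol r s A B x y z \<and> h x = h y \<and> h y = h z \<longrightarrow> D' dvd r * int x - s * k"
    using assms(2) unfolding forces_dvd_def by blast
  show ?thesis
    unfolding forces_dvd_def
    by (rule exI[of _ "\<lambda>x. prod_encode (g x, h x)"])
      (use finite_range_prod_encode[OF g(1) h(1)] g(2) h(2) assms(3) in
        \<open>auto intro!: divides_mult\<close>)
qed

text \<open>The prime power parts of \<open>D\<close> are pairwise coprime, so their colourings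
  combine.\<close>

lemma forces_dvd_oblong:
  assumes t: "t \<noteq> 0" and r: "r > 0" and s: "s > 0" and D: "D > 0"
  shows "forces_dvd r s (t * (t - 1)) (t * (t + 1)) (- t\<^sup>2) D"
proof -
  let ?Q = "forces_dvd r s (t * (t - 1)) (t * (t + 1)) (- t\<^sup>2)"
  have "finite F \<Longrightarrow> F \<subseteq> prime_factors D \<Longrightarrow> ?Q (\<Prod>p\<in>F. p ^ multiplicity p D)" for F
  proof (induction F rule: finite_induct)
    case empty
    then show ?case
      unfolding forces_dvd_def by (auto intro: exI[of _ "\<lambda>_. 0"])
  next
    case (insert p F)
    have "prime p" using insert.prems by auto
    moreover have "coprime (p ^ multiplicity p D) (\<Prod>p\<in>F. p ^ multiplicity p D)"
    proof (intro prod_coprime_right)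
      fix p' assume "p' \<in> F"
      then have "prime p'" "p \<noteq> p'" using insert by auto
      then show "coprime (p ^ multiplicity p D) (p' ^ multiplicity p' D)"
        using \<open>prime p\<close> by (simp add: primes_coprime)
    qed
    ultimately show ?case
      using insert t r s
      by (simp add: forces_dvd_mult_coprime forces_dvd_prime_power)
  qed
  then have "?Q (\<Prod>p\<in>prime_factors D. p ^ multiplicity p D)"
    by simp
  then show ?thesis
    using D by (simp add: prod_prime_factors)
qed

section \<open>Change of scale\<close>

lemma scaled_sol_iff_int_sol:
  assumes "s > 0"
  shows "scaled_sol (of_int r / of_int s) A B x y z \<longleftrightarrow> int_sol r s A B x y z"
proof -
  have s: "(of_int s :: rat) \<noteq> 0" using assms by simp
  have "(of_int r / of_int s :: rat) * of_nat z =
      (of_int r / of_int s * of_nat x + of_int B) * (of_int r / of_int s * of_nat y + of_int A)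
    \<longleftrightarrow> (of_int (s * r * int z) :: rat) = of_int ((r * int x + s * B) * (r * int y + s * A))"
    using s by (simp add: divide_simps) (simp add: algebra_simps)
  then show ?thesis
    unfolding scaled_sol_def int_sol_def of_int_eq_iff by simp
qed

text \<open>Refines an arbitrary colouring \<open>f\<close> so that closeness to \<open>k\<close>
  holds for all three entries.\<close>

lemma mono_sols_forced:
  fixes f :: "nat \<Rightarrow> nat"
  assumes f: "finite (range f)" and s: "s > 0"
    and D: "D > 0" and force: "forces_dvd r s A B k D"
  shows "\<exists>h::nat \<Rightarrow> nat. finite (range h) \<and> (\<forall>x y z. scaled_sol (of_int r / of_int s) A B x y z \<longrightarrow>
    h x = h y \<longrightarrow> h y = h z \<longrightarrow> f x = f y \<and> f y = f z \<and>
    (\<forall>w\<in>{x, y, z}. D dvd r * int w - s * k))"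
proof -
  obtain g :: "nat \<Rightarrow> nat" where g: "finite (range g)"
    "\<forall>x y z. int_sol r s A B x y z \<and> g x = g y \<and> g y = g z \<longrightarrow> D dvd r * int x - s * k"
    using force unfolding forces_dvd_def by blast
  \<comment> \<open>The residue modulo \<open>D\<close> carries the congruence from \<open>x\<close>
    over to \<open>y\<close> and \<open>z\<close>.\<close>
  define m where "m x = nat (int x mod int (nat D))" for x
  define h where "h x = prod_encode (f x, prod_encode (g x, m x))" for x
  have "finite (range h)"
    unfolding h_def m_def using f g(1) D by (intro finite_range_prod_encode finite_range_mod) auto
  moreover have "f x = f y \<and> f y = f z \<and> (\<forall>w\<in>{x, y, z}. D dvd r * int w - s * k)"
    if sol: "scaled_sol (of_int r / of_int s) A B x y z" and mono: "h x = h y" "h y = h z" for x y z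
  proof -
    have x: "D dvd r * int x - s * k"
      using g(2)[rule_format, of x y z] sol mono
      by (simp add: h_def scaled_sol_iff_int_sol[OF s])
    have w: "D dvd r * int w - s * k" if "h x = h w" for w
    proof -
      have "D dvd r * (int x - int w)"
        using that D nat_mod_eq_imp_dvd[of x "nat D" w] by (auto simp: h_def m_def)
      with x have "D dvd (r * int x - s * k) - r * (int x - int w)"
        by (rule dvd_diff)
      then show ?thesis by (simp add: algebra_simps)
    qed
    show ?thesis
      using mono w by (auto simp: h_def)
  qed
  ultimately show ?thesis by blast
qed

text \<open>Multiplication by \<open>e / d\<close> takes solutions at scale \<open>r / s\<close> to
  solutions at scale \<open>c'\<close>. The forced congruence makes it integral, so a colouring at
  the new scale can be pulled back.\<close>

lemma mono_sols_rescale: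
  assumes inf: "\<And>f. finite (range f) \<Longrightarrow> infinite (mono_sols (of_int r / of_int s) A B f)"
    and s: "s > 0" and D: "D > 0" and force: "forces_dvd r s A B k D"
    and d: "d > 0" and e: "e > 0"
    and dvd: "\<And>w. D dvd r * w - s * k \<Longrightarrow> d dvd e * w"
    and c': "of_int r / of_int s = c' * (of_int e / of_int d)"
    and f: "finite (range f)"
  shows "infinite (mono_sols c' A B f)"
proof -
  \<comment> \<open>By \<open>dvd\<close> the division is exact wherever the forced congruence
    holds.\<close>
  define \<phi> where "\<phi> w = nat (e * int w div d)" for w
  have \<phi>: "(of_nat (\<phi> w) :: rat) = of_int e / of_int d * of_nat w" "w > 0 \<Longrightarrow> \<phi> w > 0"
    if w: "D dvd r * int w - s * k" for w
  proof -
    obtain v where v: "e * int w = d * v" using dvd[OF w] unfolding dvd_def by blast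
    have "v \<ge> 0" using v d e
      by (metis mult_nonneg_nonneg of_nat_0_le_iff less_imp_le zero_le_mult_iff not_less)
    have \<phi>w: "int (\<phi> w) = v" using v d \<open>v \<ge> 0\<close> by (simp add: \<phi>_def)
    have "(of_int d :: rat) * of_int v = of_int e * of_nat w"
      using v by (metis of_int_mult of_int_of_nat_eq)
    moreover have "(of_nat (\<phi> w) :: rat) = of_int v"
      using \<phi>w by (metis of_int_of_nat_eq)
    ultimately show "(of_nat (\<phi> w) :: rat) = of_int e / of_int d * of_nat w"
      using d by (simp add: field_simps)
    show "\<phi> w > 0" if "w > 0"
      using v \<phi>w that e d \<open>v \<ge> 0\<close> by (cases "v = 0") auto
  qed
  have f': "finite (range (\<lambda>w. f (\<phi> w)))"
    by (rule finite_subset[OF _ f]) auto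
  obtain h :: "nat \<Rightarrow> nat" where h: "finite (range h)"
    "\<And>x y z. scaled_sol (of_int r / of_int s) A B x y z \<Longrightarrow> h x = h y \<Longrightarrow> h y = h z \<Longrightarrow>
      f (\<phi> x) = f (\<phi> y) \<and> f (\<phi> y) = f (\<phi> z) \<and> (\<forall>w\<in>{x, y, z}. D dvd r * int w - s * k)"
    using mono_sols_forced[OF f' s D force] by blast
  let ?M = "mono_sols (of_int r / of_int s) A B h"
  have "infinite ?M" using inf h(1) .
  moreover have "inj_on (map_prod \<phi> \<phi>) ?M"
  proof (rule inj_on_subset)
    have "inj_on \<phi> {w. D dvd r * int w - s * k}"
    proof (rule inj_onI, clarsimp)
      fix v w assume "D dvd r * int v - s * k" "D dvd r * int w - s * k" "\<phi> v = \<phi> w"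
      then have "(of_int e / of_int d * of_nat v :: rat) = of_int e / of_int d * of_nat w"
        using \<phi>(1) by metis
      then show "v = w" using d e by simp
    qed
    then show "inj_on (map_prod \<phi> \<phi>)
        ({w. D dvd r * int w - s * k} \<times> {w. D dvd r * int w - s * k})"
      by (intro map_prod_inj_on)
    show "?M \<subseteq> {w. D dvd r * int w - s * k} \<times> {w. D dvd r * int w - s * k}"
      unfolding mono_sols_def using h(2) by fastforce
  qed
  moreover have "map_prod \<phi> \<phi> ` ?M \<subseteq> mono_sols c' A B f"
  proof clarsimp
    fix x y assume "(x, y) \<in> ?M"
    then obtain z where sol: "scaled_sol (of_int r / of_int s) A B x y z" "h x = h y" "h y = h z"
      unfolding mono_sols_def by blast
    note hz = h(2)[OF sol]
    have scale: "c' * of_nat (\<phi> w) = of_int r / of_int s * of_nat w"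
      if "D dvd r * int w - s * k" for w
      by (simp only: \<phi>(1)[OF that] c' mult.assoc)
    have "scaled_sol c' A B (\<phi> x) (\<phi> y) (\<phi> z)"
      using sol(1) hz \<phi>(2) unfolding scaled_sol_def by (simp add: scale)
    then show "(\<phi> x, \<phi> y) \<in> mono_sols c' A B f"
      unfolding mono_sols_def using hz by blast
  qed
  ultimately show ?thesis
    using finite_subset finite_imageD by blast
qed

text \<open>Multiplication by \<open>c\<close> leads to scale \<open>1\<close>, division by
  \<open>c\<close> leads back. The latter is integral near \<open>k\<close> if \<open>k / c\<close>
  is an integer, and a single forced solution at scale \<open>c\<close> shows that it must
  be.\<close>

lemma mono_sols_rescale_iff:
  assumes r: "r > 0" and s: "s > 0" and c: "c = of_int r / of_int s"
    and force: "\<And>r s D. r > 0 \<Longrightarrow> s > 0 \<Longrightarrow> D > 0 \<Longrightarrow> forces_dvd r s A B k D"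
  shows "(\<forall>f. finite (range f) \<longrightarrow> infinite (mono_sols c A B f)) \<longleftrightarrow>
    (\<forall>f. finite (range f) \<longrightarrow> infinite (mono_sols 1 A B f)) \<and> of_int k / c \<in> \<int>"
    (is "?L \<longleftrightarrow> ?R \<and> _")
proof -
  have kc: "of_int k / c \<in> \<int> \<longleftrightarrow> r dvd s * k"
  proof -
    have "of_int k / c = of_int (s * k) / of_int r"
      using r s by (simp add: c field_simps)
    then show ?thesis
      using r by (simp only: of_int_div_of_int_in_Ints_iff) auto
  qed
  have rs: "r * s > 0" using r s by simp
  have ?R if ?L
  proof (intro allI impI)
    fix f :: "nat \<Rightarrow> nat" assume f: "finite (range f)"
    show "infinite (mono_sols 1 A B f)"
    \<comment> \<open>The map is \<open>w -> r w / s\<close>; the factor \<open>s\<close> of the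
      modulus ensures integrality.\<close>
    proof (rule mono_sols_rescale[OF _ s rs force[OF r s rs] s r])
      fix w assume "r * s dvd r * w - s * k"
      then have "s dvd (r * w - s * k) + s * k" by (intro dvd_add) (auto dest: dvd_mult_right)
      then show "s dvd r * w" by simp
    qed (use that c f in auto)
  qed
  moreover have "r dvd s * k" if ?L
  proof -
    obtain h :: "nat \<Rightarrow> nat" where h: "finite (range h)"
      "\<And>x y z. scaled_sol (of_int r / of_int s) A B x y z \<Longrightarrow> h x = h y \<Longrightarrow> h y = h z \<Longrightarrow>
        (\<forall>w\<in>{x, y, z}. r * s dvd r * int w - s * k)"
      using mono_sols_forced[OF _ s rs force[OF r s rs], of "\<lambda>_. 0"] by auto
    have "mono_sols c A B h \<noteq> {}"
      using that h(1) by fastforce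
    then obtain x where "r * s dvd r * int x - s * k"
      using h(2) unfolding mono_sols_def c by blast
    then have "r dvd r * int x - s * k" by (rule dvd_mult_left)
    then show ?thesis by (simp add: dvd_diff_right_iff)
  qed
  moreover have ?L if ?R "r dvd s * k"
  proof (intro allI impI)
    fix f :: "nat \<Rightarrow> nat" assume f: "finite (range f)"
    show "infinite (mono_sols c A B f)"
    \<comment> \<open>The map is \<open>w -> s w / r\<close>, integral because \<open>w\<close> is
      congruent to \<open>k\<close> modulo \<open>r\<close> and \<open>r\<close> divides
      \<open>s * k\<close>.\<close>
    proof (rule mono_sols_rescale[where r = 1 and s = 1 and D = r and d = r and e = s and k = k])
      fix w assume "r dvd 1 * w - 1 * k"
      then have "r dvd s * (w - k) + s * k" using that(2)
        by (intro dvd_add dvd_mult[of r "w - k" s]) auto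
      then show "r dvd s * w" by (simp add: algebra_simps)
    qed (use that(1) f r s c force in auto)
  qed
  ultimately show ?thesis using kc by blast
qed

section \<open>Schur's theorem and the case \<open>t = 0\<close>\<close>

text \<open>
  Schur's theorem applied to the exponents \<open>i\<close> in \<open>c x = (2 r) ^ Suc i\<close>; the differences of an
  infinite homogeneous set give infinitely many triples at once.
\<close>

lemma infinite_mono_sols_product:
  assumes r: "r > 0" and s: "s > 0" and c: "c = of_int r / of_int s" and f: "finite (range f)"
  shows "infinite (mono_sols c 0 0 f)"
proof -
  \<comment> \<open>The factor \<open>s\<close> clears the denominator of \<open>c\<close>. The base
    \<open>2 * r\<close> exceeds \<open>1\<close> even for \<open>r = 1\<close>, so distinct
    positive exponents give distinct numbers; \<open>i - 1\<close> truncates only at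
    \<open>i = 0\<close>, which positive differences avoid.\<close>
  define X where "X i = nat (2 * s * (2 * r) ^ (i - 1))" for i :: nat
  have Xc: "c * of_nat (X i) = of_int (2 * r) ^ i" if "i > 0" for i
    using r s that by (cases i) (auto simp: X_def c)
  have Xpos: "X i > 0" for i
    using r s by (simp add: X_def)
  have Xinj: "i = j" if "X i = X j" "i > 0" "j > 0" for i j
  proof -
    have "(of_int (2 * r) :: rat) ^ i = of_int (2 * r) ^ j"
      using that Xc by metis
    moreover have "(of_int (2 * r) :: rat) > 1" using r by simp
    ultimately show ?thesis using power_inject_exp by blast
  qed
  obtain N where N: "f x < N" for x
    using f by (auto simp: finite_nat_set_iff_bounded)
  obtain H col where H: "infinite H" and
    hom: "\<And>i j. i \<in> H \<Longrightarrow> j \<in> H \<Longrightarrow> i \<noteq> j \<Longrightarrow> f (X (Max {i, j} - Min {i, j})) = col"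
    using Ramsey2[of "UNIV :: nat set" "\<lambda>e. f (X (Max e - Min e))" N] N by auto
  \<comment> \<open>\<open>i\<close> and \<open>j\<close> stay fixed while \<open>l\<close> runs
    through the rest of \<open>H\<close>; the exponents satisfy
    \<open>(j - i) + (l - j) = l - i\<close>.\<close>
  obtain i where i: "i \<in> H" using H by fastforce
  obtain j where j: "j \<in> H" "i < j" using H by (meson infinite_nat_iff_unbounded)
  define K where "K = {l \<in> H. j < l}"
  have K: "infinite K"
  proof
    assume "finite K"
    moreover have "H \<subseteq> K \<union> {..j}" by (auto simp: K_def)
    ultimately show False using H finite_subset by blast
  qed
  have inj: "inj_on (\<lambda>l. (X (j - i), X (l - j))) K"
  proof (rule inj_onI)
    fix l l' assume l: "l \<in> K" "l' \<in> K" "(X (j - i), X (l - j)) = (X (j - i), X (l' - j))"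
    then have "l - j = l' - j" by (intro Xinj[of "l - j" "l' - j"]) (auto simp: K_def)
    then show "l = l'" using l by (auto simp: K_def)
  qed
  have "(X (j - i), X (l - j)) \<in> mono_sols c 0 0 f" if "l \<in> K" for l
  proof -
    have l: "l \<in> H" "j < l" using that by (auto simp: K_def)
    have "f (X (j - i)) = col" "f (X (l - j)) = col" "f (X (l - i)) = col"
      using hom[OF i j(1)] hom[OF j(1) l(1)] hom[OF i l(1)] j l by (auto simp: max_def min_def)
    moreover have "scaled_sol c 0 0 (X (j - i)) (X (l - j)) (X (l - i))"
      unfolding scaled_sol_def using Xpos j(2) l(2)
      by (simp add: Xc flip: power_add del: of_int_mult)
    ultimately show ?thesis
      unfolding mono_sols_def by auto
  qed
  then have "(\<lambda>l. (X (j - i), X (l - j))) ` K \<subseteq> mono_sols c 0 0 f" by blast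
  with inj K show ?thesis
    using finite_imageD finite_subset by blast
qed

section \<open>Translation of the integrality conditions into \<open>k / c\<close>\<close>

theorem theoremC:
  fixes q :: rat and a b :: nat and n m t :: int
  assumes "q > 0" and "a > 0" and "b > 0"
    and "(q * of_nat a * of_int m = of_int (t^2) \<and> q * of_nat b * of_int n = of_int ((t + 1)^2)) \<or>
         (q * of_nat a * of_int m = of_int (t * (t - 1)) \<and> q * of_nat b * of_int n = of_int (t * (t + 1)))"
  shows "partition_regular
           [\<lambda>x y. of_nat x,
            \<lambda>x y. of_nat y,
            \<lambda>x y. q * (of_nat a * of_nat x + of_int n) * (of_nat b * of_nat y + of_int m)]
         \<longleftrightarrow>
         partition_regular
           [\<lambda>x y. of_nat x,
            \<lambda>x y. of_nat y,
            \<lambda>x y. (of_nat x + q * of_nat b * of_int n) * (of_nat y + q * of_nat a * of_int m)]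
         \<and>
         ((q * of_nat a * of_int m = of_int (t^2) \<and> q * of_nat b * of_int n = of_int ((t + 1)^2) \<and>
           (of_nat a * of_int m + of_nat b * of_int n) / (2 * of_nat a * of_nat b)
             - 1 / (2 * q * of_nat a * of_nat b) \<in> \<int>)
          \<or>
          (q * of_nat a * of_int m = of_int (t * (t - 1)) \<and> q * of_nat b * of_int n = of_int (t * (t + 1)) \<and>
           (of_nat a * of_int m + of_nat b * of_int n) / (2 * of_nat a * of_nat b) \<in> (\<int> :: rat set)))"
proof -
  define c where "c = q * of_nat a * of_nat b"
  have "c > 0" using assms(1-3) by (simp add: c_def)
  then obtain r s where rs: "r > 0" "s > 0" "c = of_int r / of_int s"
    by (cases c rule: Rat_cases) (auto simp: Fract_of_int_quotient zero_less_divide_iff)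
  \<comment> \<open>The hypotheses make both numbers integers, so the floors are exact.\<close>
  define A B where "A = \<lfloor>q * of_nat a * of_int m\<rfloor>" and "B = \<lfloor>q * of_nat b * of_int n\<rfloor>"
  have AB: "q * of_nat a * of_int m = of_int A" "q * of_nat b * of_int n = of_int B"
    using assms(4) by (auto simp only: A_def B_def floor_of_int)
  have P1: "partition_regular
           [\<lambda>x y. of_nat x,
            \<lambda>x y. of_nat y,
            \<lambda>x y. q * (of_nat a * of_nat x + of_int n) * (of_nat b * of_nat y + of_int m)]
      \<longleftrightarrow> (\<forall>f. finite (range f) \<longrightarrow> infinite (mono_sols c A B f))"
    using \<open>c > 0\<close> by (intro partition_regular_iff_mono_sols) (simp_all add: c_def algebra_simps flip: AB)
  have P2: "partition_regular
           [\<lambda>x y. of_nat x,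
            \<lambda>x y. of_nat y,
            \<lambda>x y. (of_nat x + q * of_nat b * of_int n) * (of_nat y + q * of_nat a * of_int m)]
      \<longleftrightarrow> (\<forall>f. finite (range f) \<longrightarrow> infinite (mono_sols 1 A B f))"
    by (intro partition_regular_iff_mono_sols) (simp_all add: AB)
  have sum: "(of_nat a * of_int m + of_nat b * of_int n) / (2 * of_nat a * of_nat b) =
      of_int (A + B) / (2 * c)"
    using assms(1-3) by (simp add: c_def field_simps flip: AB)
  have inv: "1 / (2 * q * of_nat a * of_nat b) = 1 / (2 * c)"
    by (simp add: c_def mult.assoc)
  have eqs: "of_int A = (of_int x :: rat) \<longleftrightarrow> A = x" "of_int B = (of_int x :: rat) \<longleftrightarrow> B = x" for x
    by simp_all
  have goal: "(\<forall>f. finite (range f) \<longrightarrow> infinite (mono_sols c A B f)) \<longleftrightarrow>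
      (\<forall>f. finite (range f) \<longrightarrow> infinite (mono_sols 1 A B f)) \<and>
      (A = t\<^sup>2 \<and> B = (t + 1)\<^sup>2 \<and> of_int (A + B) / (2 * c) - 1 / (2 * c) \<in> \<int> \<or>
       A = t * (t - 1) \<and> B = t * (t + 1) \<and> of_int (A + B) / (2 * c) \<in> \<int>)"
    using assms(4) unfolding AB eqs
  proof
    assume a: "A = t\<^sup>2 \<and> B = (t + 1)\<^sup>2"
    \<comment> \<open>Here \<open>A + B - 1 = 2 * t * (t + 1)\<close>, so the quantity is
      \<open>- k / c\<close>.\<close>
    then have "of_int (A + B) / (2 * c) - 1 / (2 * c) = - (of_int (- (t * (t + 1))) / c)"
      using \<open>c > 0\<close> by (simp add: field_simps power2_eq_square)
    then have "of_int (A + B) / (2 * c) - 1 / (2 * c) \<in> \<int> \<longleftrightarrow> of_int (- (t * (t + 1))) / c \<in> \<int>"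
      by (simp only: minus_in_Ints_iff)
    \<comment> \<open>Equal values of \<open>A\<close> would force \<open>t = 0\<close>, and then
      \<open>B\<close> would be both \<open>1\<close> and \<open>0\<close>.\<close>
    moreover have "\<not> (A = t * (t - 1) \<and> B = t * (t + 1))"
      using a by (auto simp: power2_eq_square algebra_simps)
    ultimately show ?thesis
      using mono_sols_rescale_iff[OF rs, of A B "- (t * (t + 1))"] forces_dvd_square a by blast
  next
    assume b: "A = t * (t - 1) \<and> B = t * (t + 1)"
    then have "A + B = 2 * t\<^sup>2"
      by (simp add: power2_eq_square algebra_simps)
    then have "of_int (A + B) / (2 * c) = - (of_int (- t\<^sup>2) / c)"
      by simp
    then have int: "of_int (A + B) / (2 * c) \<in> \<int> \<longleftrightarrow> of_int (- t\<^sup>2) / c \<in> \<int>"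
      by (simp only: minus_in_Ints_iff)
    have ne: "\<not> (A = t\<^sup>2 \<and> B = (t + 1)\<^sup>2)"
      using b by (auto simp: power2_eq_square algebra_simps)
    show ?thesis
    \<comment> \<open>For \<open>t = 0\<close> the root \<open>k + 1\<close> cannot be excluded, but
      \<open>A = B = 0\<close>, so both patterns are partition regular by Schur and the integrality
      condition concerns \<open>0\<close>.\<close>
    proof (cases "t = 0")
      case True
      then show ?thesis
        using b infinite_mono_sols_product[OF rs] infinite_mono_sols_product[of 1 1 1] by simp
    next
      case False
      then show ?thesis
        using mono_sols_rescale_iff[OF rs, of A B "- t\<^sup>2"] forces_dvd_oblong b int ne by blast
    qed
  qed
  show ?thesis
    unfolding P1 P2 unfolding sum inv AB eqs by (rule goal)
qed

end
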